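(* There is an algorithm that, given a split graph $G$ of order $n$, enumerates all minimal Roman dominating functions of $G$ in time $\mathcal{O}^*(1.4656^n)$.
   Context: All graphs are finite, undirected and simple. A split graph is a graph $G=(V,E)$ whose vertex set can be partitioned into a clique $C$ and an independent set $I$. For a graph $G=(V,E)$, a function $f\colon V\to\{0,1,2\}$ is a Roman dominating function (rdf) if every vertex $v$ with $f(v)=0$ has a neighbor $u$ with $f(u)=2$. Functions $V\to\{0,1,2\}$ are ordered pointwise: $f\le g$ iff $f(v)\le g(v)$ for all $v\in V$. An rdf $f$ is minimal if there is no rdf $g\neq f$ with $g\le f$. The notation $\mathcal{O}^*(\cdot)$ suppresses factors polynomial in $n$. *)

theory Defs
  imports Complex_Main "HOL-Library.FuncSet" "HOL-Library.Ramsey" "HOL-Library.Landau_Symbols"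
begin

section \<open>Split graphs and Roman domination\<close>

text \<open>Edges are two-element sets of vertices, so graphs are undirected and simple. The predicates
  \<^const>\<open>clique\<close> and \<^const>\<open>indep\<close> for this representation come from the Ramsey theory.\<close>

definition simple_graph :: "'a set \<Rightarrow> 'a set set \<Rightarrow> bool" where
  "simple_graph V E \<longleftrightarrow> finite V \<and> E \<subseteq> [V]\<^bsup>2\<^esup>"

definition split_graph :: "'a set \<Rightarrow> 'a set set \<Rightarrow> bool" where
  "split_graph V E \<longleftrightarrow> simple_graph V E \<and>
     (\<exists>C I. C \<union> I = V \<and> C \<inter> I = {} \<and> clique C E \<and> indep I E)"

text \<open>Functions \<open>V \<rightarrow> {0, 1, 2}\<close> are extensional, so that distinct HOL functions differ on \<open>V\<close>.\<close>

definition rdf :: "'a set \<Rightarrow> 'a set set \<Rightarrow> ('a \<Rightarrow> nat) \<Rightarrow> bool" where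
  "rdf V E f \<longleftrightarrow> f \<in> V \<rightarrow>\<^sub>E {0, 1, 2} \<and>
     (\<forall>v\<in>V. f v = 0 \<longrightarrow> (\<exists>u\<in>V. {u, v} \<in> E \<and> f u = 2))"

definition minimal_rdf :: "'a set \<Rightarrow> 'a set set \<Rightarrow> ('a \<Rightarrow> nat) \<Rightarrow> bool" where
  "minimal_rdf V E f \<longleftrightarrow> rdf V E f \<and>
     \<not> (\<exists>g. rdf V E g \<and> g \<noteq> f \<and> (\<forall>v\<in>V. g v \<le> f v))"

section \<open>Model of computation\<close>

text \<open>Algorithms are programs of a first-order, call-by-value functional language with general
  recursion, whose only data are unlabelled binary trees. A program is the list of the bodies of
  its functions; \<open>Arg i\<close> is the \<open>i\<close>-th argument of the current function and \<open>Call g es\<close> calls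
  function number \<open>g\<close>. Function \<open>0\<close> is the entry point.

  Each evaluation step has unit cost. This is a realistic measure: a step only handles a number of
  pointers bounded in terms of the program (\<open>MkNode\<close> allocates one cell, and \<open>IfNode\<close> only tests whether
  a tree is a leaf), so that a random-access machine that stores trees as shared
  pointer structures simulates a computation of cost \<open>t\<close> in \<open>O(t)\<close> steps, on addresses of
  \<open>O(log (s + t))\<close> bits for an input of size \<open>s\<close>. There is no unbounded arithmetic and no
  unit-cost comparison of trees.\<close>

datatype tree = Leaf | Node tree tree

datatype expr =
    Arg nat
  | MkLeaf
  | MkNode expr expr
  | Left expr
  | Right expr
  | IfNode expr expr expr
  | Call nat "expr list"

type_synonym program = "expr list"

text \<open>\<open>eval P env e v t\<close>: in program \<open>P\<close>, with arguments \<open>env\<close>, evaluation of \<open>e\<close> terminates with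
  value \<open>v\<close> at cost \<open>t\<close>. There is no derivation for diverging or ill-formed computations.\<close>

inductive eval :: "program \<Rightarrow> tree list \<Rightarrow> expr \<Rightarrow> tree \<Rightarrow> nat \<Rightarrow> bool"
  and evals :: "program \<Rightarrow> tree list \<Rightarrow> expr list \<Rightarrow> tree list \<Rightarrow> nat \<Rightarrow> bool"
  for P :: program
where
  Arg: "i < length env \<Longrightarrow> eval P env (Arg i) (env ! i) 1"
| MkLeaf: "eval P env MkLeaf Leaf 1"
| MkNode: "eval P env a x s \<Longrightarrow> eval P env b y t \<Longrightarrow>
    eval P env (MkNode a b) (Node x y) (s + t + 1)"
| Left: "eval P env e (Node x y) t \<Longrightarrow> eval P env (Left e) x (t + 1)"
| Right: "eval P env e (Node x y) t \<Longrightarrow> eval P env (Right e) y (t + 1)"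
| IfNode_true: "eval P env c (Node x y) s \<Longrightarrow> eval P env a v t \<Longrightarrow>
    eval P env (IfNode c a b) v (s + t + 1)"
| IfNode_false: "eval P env c Leaf s \<Longrightarrow> eval P env b v t \<Longrightarrow>
    eval P env (IfNode c a b) v (s + t + 1)"
| Call: "g < length P \<Longrightarrow> evals P env es vs s \<Longrightarrow> eval P vs (P ! g) v t \<Longrightarrow>
    eval P env (Call g es) v (s + t + 1)"
| evals_Nil: "evals P env [] [] 0"
| evals_Cons: "eval P env e v s \<Longrightarrow> evals P env es vs t \<Longrightarrow>
    evals P env (e # es) (v # vs) (s + t)"

text \<open>Value and cost are unique, so the existence of a derivation means that \<^emph>\<open>the\<close> computation
  terminates with that value at that cost.\<close>

inductive_cases eval_elims:
  "eval P env (Arg i) v t" "eval P env MkLeaf v t" "eval P env (MkNode a b) v t"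
  "eval P env (Left e) v t" "eval P env (Right e) v t" "eval P env (IfNode c a b) v t"
  "eval P env (Call g es) v t" "evals P env [] vs t" "evals P env (e # es) vs t"

lemma eval_deterministic:
  "eval P env e v t \<Longrightarrow> (\<forall>v' t'. eval P env e v' t' \<longrightarrow> v' = v \<and> t' = t)"
  "evals P env es vs t \<Longrightarrow> (\<forall>vs' t'. evals P env es vs' t' \<longrightarrow> vs' = vs \<and> t' = t)"
proof (induction rule: eval_evals.inducts)
  case Arg
  show ?case
    by (intro allI impI, elim eval_elims; simp)
next
  case MkLeaf
  show ?case
    by (intro allI impI, elim eval_elims; simp)
next
  case MkNode
  show ?case
    by (intro allI impI, elim eval_elims) (metis MkNode.IH tree.inject tree.distinct(1) Suc_eq_plus1)+
next
  case Left
  show ?case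
    by (intro allI impI, elim eval_elims) (metis Left.IH tree.inject tree.distinct(1) Suc_eq_plus1)+
next
  case Right
  show ?case
    by (intro allI impI, elim eval_elims) (metis Right.IH tree.inject tree.distinct(1) Suc_eq_plus1)+
next
  case IfNode_true
  show ?case
    by (intro allI impI, elim eval_elims) (metis IfNode_true.IH tree.inject tree.distinct(1) Suc_eq_plus1)+
next
  case IfNode_false
  show ?case
    by (intro allI impI, elim eval_elims) (metis IfNode_false.IH tree.inject tree.distinct(1) Suc_eq_plus1)+
next
  case Call
  show ?case
    by (intro allI impI, elim eval_elims) (metis Call.IH tree.inject tree.distinct(1) Suc_eq_plus1)+
next
  case evals_Nil
  show ?case
    by (intro allI impI, elim eval_elims; simp)
next
  case evals_Cons
  show ?case
    by (intro allI impI, elim eval_elims) (metis evals_Cons.IH tree.inject tree.distinct(1) Suc_eq_plus1)+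
qed

definition computes :: "program \<Rightarrow> tree \<Rightarrow> tree \<Rightarrow> nat \<Rightarrow> bool" where
  "computes P x y t \<longleftrightarrow> eval P [x] (Call 0 [Arg 0]) y t"

section \<open>Input and output\<close>

text \<open>Numbers are encoded in unary; only \<open>0\<close>, \<open>1\<close> and \<open>2\<close> occur below.\<close>

fun enc_nat :: "nat \<Rightarrow> tree" where
  "enc_nat 0 = Leaf"
| "enc_nat (Suc k) = Node Leaf (enc_nat k)"

fun enc_list :: "tree list \<Rightarrow> tree" where
  "enc_list [] = Leaf"
| "enc_list (x # xs) = Node x (enc_list xs)"

text \<open>A graph with vertex set \<open>{..<n}\<close> is given by its adjacency matrix, a function on \<open>{..<n}\<close> by
  the list of its values.\<close>

definition enc_graph :: "nat \<Rightarrow> nat set set \<Rightarrow> tree" where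
  "enc_graph n E =
     enc_list (map (\<lambda>i. enc_list (map (\<lambda>j. enc_nat (of_bool ({i, j} \<in> E))) [0..<n])) [0..<n])"

definition enc_fun :: "nat \<Rightarrow> (nat \<Rightarrow> nat) \<Rightarrow> tree" where
  "enc_fun n f = enc_list (map (\<lambda>i. enc_nat (f i)) [0..<n])"

text \<open>Each minimal Roman dominating function is output exactly once, in any order.\<close>

definition enumerates_minimal_rdfs :: "program \<Rightarrow> nat \<Rightarrow> nat set set \<Rightarrow> nat \<Rightarrow> bool" where
  "enumerates_minimal_rdfs P n E t \<longleftrightarrow>
     (\<exists>fs. distinct fs \<and> set fs = {f. minimal_rdf {..<n} E f} \<and>
       computes P (enc_graph n E) (enc_list (map (enc_fun n) fs)) t)"

section \<open>Asymptotics\<close>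

definition bigostar :: "(nat \<Rightarrow> real) \<Rightarrow> (nat \<Rightarrow> real) set" (\<open>O\<^sup>*'(_')\<close>) where
  "O\<^sup>*(g) = (\<Union>k::nat. O(\<lambda>n. real n ^ k * g n))"

end

theory Submission
  imports Defs
begin

text \<open>
  A minimal Roman dominating function is determined by the set \<open>S\<close> of vertices of value \<open>2\<close>: the
  other vertices get \<open>0\<close> if they have a neighbour in \<open>S\<close> and \<open>1\<close> otherwise. The sets \<open>S\<close> that arise
  are those in which every \<open>v \<in> S\<close> has a private neighbour, a vertex outside \<open>S\<close> whose only
  neighbour in \<open>S\<close> is \<open>v\<close>. This property is inherited by subsets, so that inserting the vertices
  one after the other, and discarding the sets without the property at once, takes time polynomial
  per output on every graph.

  Only the number of these sets depends on the graph being split. Two vertices of \<open>S\<close> in the clique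
  exclude private neighbours in the clique, and one excludes all vertices of the independent set
  from \<open>S\<close>; hence \<open>S\<close> is a singleton, or lies in one part with all private neighbours in the other
  part. In the bipartite situation, branching on a vertex \<open>a\<close> gives the recurrence
  \<open>x\<^sup>3 = x\<^sup>2 + 1\<close>: if \<open>a \<notin> S\<close>, then \<open>a\<close> is deleted, and if \<open>a \<in> S\<close>, then its neighbours can no longer be
  private to others, so that at least three vertices disappear. If \<open>a\<close> has a single neighbour \<open>b\<close>,
  the third one is another neighbour of \<open>b\<close>, which cannot be in \<open>S\<close>; if there is none, \<open>b\<close> is
  useless without \<open>a\<close> and both branches delete \<open>a\<close> and \<open>b\<close>.
\<close>

section \<open>Counting sets with private neighbours\<close>

text \<open>Members are chosen from \<open>A\<close>, and \<open>B\<close> offers the private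
  neighbours. Keeping the two sides apart lets an induction delete vertices from either one.\<close>

definition private_sets :: "('a \<Rightarrow> 'b \<Rightarrow> bool) \<Rightarrow> 'a set \<Rightarrow> 'b set \<Rightarrow> 'a set set" where
  "private_sets R A B = {S. S \<subseteq> A \<and> (\<forall>v\<in>S. \<exists>b\<in>B. {a \<in> S. R a b} = {v})}"

lemma finite_private_sets: "finite A \<Longrightarrow> finite (private_sets R A B)"
  by (rule finite_subset[of _ "Pow A"]) (auto simp: private_sets_def)

text \<open>Members that contain \<open>a\<close> are recovered from \<open>S - {a}\<close> by
  inserting \<open>a\<close>. The sets \<open>A'\<close>, \<open>B0\<close> and \<open>B1\<close>
  stay free because the cases of the recurrence delete different vertices.\<close>

lemma card_private_sets_branch:
  assumes "finite A" "a \<in> A" "A' \<subseteq> A"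
    and out: "\<And>S. S \<in> private_sets R A B \<Longrightarrow> a \<notin> S \<Longrightarrow> S \<in> private_sets R (A - {a}) B0"
    and into: "\<And>S. S \<in> private_sets R A B \<Longrightarrow> a \<in> S \<Longrightarrow> S - {a} \<in> private_sets R A' B1"
  shows "card (private_sets R A B) \<le> card (private_sets R (A - {a}) B0) + card (private_sets R A' B1)"
proof -
  let ?F = "private_sets R A B"
  have "private_sets R A B \<subseteq> private_sets R (A - {a}) B0 \<union> insert a ` private_sets R A' B1"
  proof
    fix S assume S: "S \<in> ?F"
    show "S \<in> private_sets R (A - {a}) B0 \<union> insert a ` private_sets R A' B1"
    proof (cases "a \<in> S")
      case True
      then have "S = insert a (S - {a})" by blast
      with into[OF S True] show ?thesis by blast
    qed (use out S in blast)
  qed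
  moreover have fin: "finite (private_sets R (A - {a}) B0)" "finite (private_sets R A' B1)"
    using assms by (auto intro!: finite_private_sets intro: finite_subset)
  ultimately have "card ?F \<le> card (private_sets R (A - {a}) B0 \<union> insert a ` private_sets R A' B1)"
    by (intro card_mono) auto
  also have "\<dots> \<le> card (private_sets R (A - {a}) B0) + card (insert a ` private_sets R A' B1)"
    by (rule card_Un_le)
  also have "\<dots> \<le> card (private_sets R (A - {a}) B0) + card (private_sets R A' B1)"
    using card_image_le[OF fin(2)] by simp
  finally show ?thesis .
qed

text \<open>A private neighbour of another member of \<open>S\<close> is not adjacent to
  \<open>a\<close>, which also lies in \<open>S\<close>; so neighbours of \<open>a\<close> may be
  dropped from \<open>B\<close>.\<close>

lemma private_sets_remove:
  assumes "S \<in> private_sets R A B" "a \<in> S" "S - {a} \<subseteq> A'" "{b \<in> B. \<not> R a b} \<subseteq> B'"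
  shows "S - {a} \<in> private_sets R A' B'"
  unfolding private_sets_def
proof (intro CollectI conjI ballI)
  fix v assume v: "v \<in> S - {a}"
  then obtain b where b: "b \<in> B" "{x \<in> S. R x b} = {v}"
    using assms(1) by (auto simp: private_sets_def)
  then have "\<not> R a b" using assms(2) v by auto
  then show "\<exists>b\<in>B'. {x \<in> S - {a}. R x b} = {v}"
    using b v assms(4) by (intro bexI[of _ b]) auto
qed (use assms in auto)

text \<open>\<open>x ^ 3 \<ge> x ^ 2 + 1\<close> pays for branches that lose one and three vertices,
  \<open>x ^ 2 \<ge> 2\<close> for two branches that lose two each. The induction is on the size of
  both sides together.\<close>

lemma card_private_sets:
  fixes x :: real
  assumes x: "x \<ge> 1" "x ^ 3 \<ge> x ^ 2 + 1" "x ^ 2 \<ge> 2"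
  shows "finite A \<Longrightarrow> finite B \<Longrightarrow> card (private_sets R A B) \<le> x ^ (card A + card B)"
proof (induction "card A + card B" arbitrary: A B rule: less_induct)
  case less
  \<comment> \<open>The induction hypothesis, weakened so that \<open>m\<close> need only bound the
    remaining size from above.\<close>
  have bound: "card (private_sets R A' B') \<le> x ^ m"
    if "A' \<subseteq> A" "B' \<subseteq> B" "card A' + card B' \<le> m" "m < card A + card B" for A' B' m
  proof -
    have "card (private_sets R A' B') \<le> x ^ (card A' + card B')"
      using that less.prems by (intro less.hyps) (auto intro: finite_subset)
    also have "\<dots> \<le> x ^ m" using that x by (intro power_increasing) auto
    finally show ?thesis .
  qed
  let ?F = "private_sets R A B"
  show ?case
  proof (cases "A = {}")
    case True
    then have "?F = {{}}" by (auto simp: private_sets_def)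
    then show ?thesis using x by simp
  next
    case False
    then obtain a where a: "a \<in> A" by blast
    define N where "N = {b \<in> B. R a b}"
    have N: "N \<subseteq> B" "finite N" using less.prems by (auto simp: N_def)
    have card_A: "card (A - {a}) = card A - 1" "card A \<ge> 1"
      using a less.prems by (auto simp: Suc_le_eq card_gt_0_iff)
    have card_N: "card (B - N) = card B - card N" "card N \<le> card B"
      using N less.prems by (auto simp: card_Diff_subset card_mono)
    have out: "S \<in> private_sets R (A - {a}) B" if "S \<in> ?F" "a \<notin> S" for S
      using that by (auto simp: private_sets_def)
    have into: "S - {a} \<in> private_sets R (A - {a}) (B - N)" if "S \<in> ?F" "a \<in> S" for S
      using that by (intro private_sets_remove) (auto simp: private_sets_def N_def)
    have three: "card ?F \<le> x ^ (card A + card B)"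
      if H: "card ?F \<le> card (private_sets R A1 B1) + card (private_sets R A2 B2)"
        "A1 \<subseteq> A" "B1 \<subseteq> B" "card A1 + card B1 + 1 \<le> card A + card B"
        "A2 \<subseteq> A" "B2 \<subseteq> B" "card A2 + card B2 + 3 \<le> card A + card B" for A1 B1 A2 B2
    proof -
      obtain m where m: "card A + card B = m + 3" using H(7) by (metis add.commute le_Suc_ex add.assoc)
      have "real (card (private_sets R A1 B1)) \<le> x ^ (m + 2)" using H m by (intro bound) auto
      moreover have "real (card (private_sets R A2 B2)) \<le> x ^ m" using H m by (intro bound) auto
      ultimately have "card ?F \<le> x ^ (m + 2) + x ^ m" using H(1) by linarith
      also have "\<dots> = x ^ m * (x ^ 2 + 1)" by (simp add: power_add power2_eq_square algebra_simps)
      also have "\<dots> \<le> x ^ m * x ^ 3" using x by (intro mult_left_mono) auto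
      finally show ?thesis using m by (simp add: power_add)
    qed
    consider "card N = 0" | b where "N = {b}" | "card N \<ge> 2"
      by (metis One_nat_def card_1_singletonE less_2_cases not_le)
    then show ?thesis
    proof cases
      case 1
      then have N0: "N = {}" using N by simp
      have "?F \<subseteq> private_sets R (A - {a}) B"
      proof
        fix S assume S: "S \<in> ?F"
        \<comment> \<open>Without neighbours in \<open>B\<close>, \<open>a\<close> has no private
          neighbour.\<close>
        have "a \<notin> S" using S N0 by (force simp: private_sets_def N_def)
        then show "S \<in> private_sets R (A - {a}) B" using out S by blast
      qed
      then have "card ?F \<le> card (private_sets R (A - {a}) B)"
        using less.prems by (intro card_mono finite_private_sets) auto
      also have "real \<dots> \<le> x ^ (card A + card B - 1)" using card_A by (intro bound) auto
      also have "\<dots> \<le> x ^ (card A + card B)" using x by (intro power_increasing) auto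
      finally show ?thesis by simp
    next
      case 3
      have "card ?F \<le> card (private_sets R (A - {a}) B) + card (private_sets R (A - {a}) (B - N))"
        using a less.prems out into by (intro card_private_sets_branch) auto
      then show ?thesis using 3 card_A card_N by (rule_tac three) auto
    next
      case 2
      have b: "b \<in> B" "R a b" using 2 by (auto simp: N_def)
      have card_N1: "card (B - N) + 1 = card B" using 2 card_N by simp
      \<comment> \<open>\<open>b\<close> is the only candidate for a private neighbour of
        \<open>a\<close>, so no other member of \<open>S\<close> is adjacent to it.\<close>
      have only: "{x \<in> S. R x b} = {a}" if "S \<in> ?F" "a \<in> S" for S
      proof -
        obtain c where c: "c \<in> B" "{x \<in> S. R x c} = {a}" using \<open>S \<in> ?F\<close> \<open>a \<in> S\<close> by (auto simp: private_sets_def)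
        then have "c \<in> N" by (auto simp: N_def)
        then show ?thesis using c 2 by auto
      qed
      show ?thesis
      proof (cases "\<exists>a'\<in>A - {a}. R a' b")
        case True
        then obtain a' where a': "a' \<in> A" "a' \<noteq> a" "R a' b" by blast
        have "S - {a} \<in> private_sets R (A - {a} - {a'}) (B - N)" if S: "S \<in> ?F" "a \<in> S" for S
        proof -
          have "a' \<notin> S" using only[OF S] a' by auto
          then show ?thesis
            using S by (intro private_sets_remove) (auto simp: private_sets_def N_def)
        qed
        then have "card ?F \<le> card (private_sets R (A - {a}) B) + card (private_sets R (A - {a} - {a'}) (B - N))"
          using a less.prems out by (intro card_private_sets_branch) auto
        moreover have "card (A - {a} - {a'}) + 2 = card A"
          using card_Suc_Diff1[of A a] card_Suc_Diff1[of "A - {a}" a'] a a' less.prems by simp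
        ultimately show ?thesis using card_A card_N1 by (rule_tac three) auto
      next
        case False
        have "S \<in> private_sets R (A - {a}) (B - N)" if S: "S \<in> ?F" "a \<notin> S" for S
          unfolding private_sets_def
        proof (intro CollectI conjI ballI)
          show "S \<subseteq> A - {a}" using that by (auto simp: private_sets_def)
          fix v assume "v \<in> S"
          then obtain c where c: "c \<in> B" "{x \<in> S. R x c} = {v}"
            using S(1) unfolding private_sets_def by blast
          then have "v \<in> S" "R v c" by auto
          \<comment> \<open>Once \<open>a\<close> is out, no member of \<open>S\<close> is adjacent
            to \<open>b\<close>; so \<open>b\<close> witnesses nothing and is deleted along with
            \<open>a\<close>.\<close>
          then have "c \<noteq> b" using False S by (auto simp: private_sets_def)
          then show "\<exists>c\<in>B - N. {x \<in> S. R x c} = {v}" using c 2 by auto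
        qed
        then have "card ?F \<le> card (private_sets R (A - {a}) (B - N)) + card (private_sets R (A - {a}) (B - N))"
          using a less.prems into by (intro card_private_sets_branch) auto
        then have *: "real (card ?F) \<le> 2 * real (card (private_sets R (A - {a}) (B - N)))" by linarith
        obtain m where m: "card A + card B = m + 2"
          using card_A card_N1 by (metis add.commute le_Suc_ex add.assoc add_Suc_right one_add_one plus_1_eq_Suc)
        have "real (card (private_sets R (A - {a}) (B - N))) \<le> x ^ m"
          using m card_A card_N1 by (intro bound) auto
        with * have "card ?F \<le> x ^ m * 2" by linarith
        also have "\<dots> \<le> x ^ m * x ^ 2" using x by (intro mult_left_mono) auto
        finally show ?thesis using m by (simp add: power2_eq_square mult_ac)
      qed
    qed
  qed
qed

section \<open>Minimal Roman dominating functions of split graphs\<close>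

text \<open>The witness lies outside \<open>S\<close>: unlike for irredundant sets, a vertex is
  never its own private neighbour, since a value 2 that serves no other vertex could be lowered to
  1.\<close>

definition private_sets_graph :: "'a set \<Rightarrow> 'a set set \<Rightarrow> 'a set set" where
  "private_sets_graph V E = {S. S \<subseteq> V \<and> (\<forall>v\<in>S. \<exists>u\<in>V - S. {w \<in> S. {u, w} \<in> E} = {v})}"

lemma finite_private_sets_graph: "finite V \<Longrightarrow> finite (private_sets_graph V E)"
  by (rule finite_subset[of _ "Pow V"]) (auto simp: private_sets_graph_def)

text \<open>Passing to a subset keeps \<open>u\<close> outside and creates no neighbours, so old
  witnesses still serve. This makes immediate pruning complete.\<close>

lemma private_sets_graph_hereditary:
  assumes "S \<in> private_sets_graph V E" "S' \<subseteq> S"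
  shows "S' \<in> private_sets_graph V E"
  unfolding private_sets_graph_def
proof (intro CollectI conjI ballI)
  show "S' \<subseteq> V" using assms by (auto simp: private_sets_graph_def)
  fix v assume v: "v \<in> S'"
  then have "v \<in> S" using assms(2) by blast
  with assms(1) have "\<exists>u\<in>V - S. {w \<in> S. {u, w} \<in> E} = {v}"
    by (simp add: private_sets_graph_def)
  then obtain u where "u \<in> V - S" "{w \<in> S. {u, w} \<in> E} = {v}" by blast
  then show "\<exists>u\<in>V - S'. {w \<in> S'. {u, w} \<in> E} = {v}"
    using v assms(2) by (intro bexI[of _ u]) auto
qed

text \<open>The two bipartite families contribute \<open>1.4656 ^ card V\<close> each, the
  singletons at most \<open>card V\<close>. The constant is the real root of
  \<open>x ^ 3 = x ^ 2 + 1\<close>, rounded up.\<close>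

lemma card_private_sets_graph:
  assumes "split_graph V E"
  shows "card (private_sets_graph V E) \<le> (real (card V) + 2) * 1.4656 ^ card V"
proof -
  from assms obtain C I where CI: "C \<union> I = V" "C \<inter> I = {}" "clique C E" "indep I E"
    and V: "finite V" and E: "E \<subseteq> [V]\<^bsup>2\<^esup>"
    by (auto simp: split_graph_def simple_graph_def)
  have fin: "finite C" "finite I" using V CI by auto
  have cards: "card C + card I = card V" using card_Un_disjoint[OF fin CI(2)] CI(1) by simp
  have edge: "x \<noteq> y" "x \<in> V" "y \<in> V" if "{x, y} \<in> E" for x y
    using that E by (auto simp: nsets_def card_insert_if split: if_splits)
  have clq: "{x, y} \<in> E" if "x \<in> C" "y \<in> C" "x \<noteq> y" for x y
    using CI(3) that by (auto simp: clique_def)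
  have ind: "{x, y} \<notin> E" if "x \<in> I" "y \<in> I" for x y
    using CI(4) that edge[of x y] by (auto simp: indep_def)
  let ?R = "\<lambda>a b. {b, a} \<in> E"
  have sub: "private_sets_graph V E \<subseteq> private_sets ?R C I \<union> private_sets ?R I C \<union> (\<lambda>c. {c}) ` C"
  proof
    fix S assume "S \<in> private_sets_graph V E"
    then have SV: "S \<subseteq> V" and priv: "\<And>v. v \<in> S \<Longrightarrow> \<exists>u\<in>V - S. {w \<in> S. {u, w} \<in> E} = {v}"
      by (auto simp: private_sets_graph_def)
    consider "S \<inter> C = {}" | c where "S \<inter> C = {c}" | c d where "c \<in> S \<inter> C" "d \<in> S \<inter> C" "c \<noteq> d" by blast
    then show "S \<in> private_sets ?R C I \<union> private_sets ?R I C \<union> (\<lambda>c. {c}) ` C"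
    proof cases
      case 1
      have SI: "S \<subseteq> I" using SV CI 1 by auto
      have "S \<in> private_sets ?R I C"
        unfolding private_sets_def
      proof (intro CollectI conjI ballI SI)
        fix v assume v: "v \<in> S"
        with priv obtain u where u: "u \<in> V - S" "{w \<in> S. {u, w} \<in> E} = {v}" by blast
        then have "{u, v} \<in> E" by auto
        then have "u \<in> C" using ind[of u v] SI v u CI by auto
        then show "\<exists>b\<in>C. {a \<in> S. {b, a} \<in> E} = {v}" using u by blast
      qed
      then show ?thesis by blast
    next
      case 2
      \<comment> \<open>Another member of \<open>S\<close> would lie in \<open>I\<close> with a
        private neighbour in \<open>C\<close>, which is adjacent to \<open>c\<close> as
        well.\<close>
      have "S = {c}"
      proof (rule ccontr)
        assume "S \<noteq> {c}"
        then obtain v where v: "v \<in> S" "v \<in> I" "v \<noteq> c" using 2 SV CI by blast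
        then obtain u where u: "u \<in> V - S" "{w \<in> S. {u, w} \<in> E} = {v}" using priv by blast
        then have "{u, v} \<in> E" by auto
        then have "u \<in> C" using ind[of u v] v u CI by auto
        then have "{u, c} \<in> E" using clq 2 u by blast
        then have "c \<in> {w \<in> S. {u, w} \<in> E}" using 2 by blast
        then show False using u v by simp
      qed
      then show ?thesis using 2 by blast
    next
      case 3
      \<comment> \<open>A clique vertex outside \<open>S\<close> sees both \<open>c\<close> and
        \<open>d\<close>; so all witnesses lie in \<open>I\<close>, and the vertices they serve lie
        in \<open>C\<close>.\<close>
      have priv': "v \<in> C \<and> (\<exists>u\<in>I. {w \<in> S. {u, w} \<in> E} = {v})" if v: "v \<in> S" for v
      proof -
        obtain u where u: "u \<in> V - S" "{w \<in> S. {u, w} \<in> E} = {v}" using priv v by blast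
        then have uv: "{u, v} \<in> E" by auto
        have "u \<notin> C"
        proof
          assume "u \<in> C"
          then have "{u, c} \<in> E" "{u, d} \<in> E" using clq 3 u by blast+
          then have "c \<in> {w \<in> S. {u, w} \<in> E}" "d \<in> {w \<in> S. {u, w} \<in> E}" using 3 by blast+
          then show False using u 3 by simp
        qed
        then have "u \<in> I" using u CI by blast
        moreover have "v \<in> C" using ind[of u v] uv \<open>u \<in> I\<close> v SV CI by blast
        ultimately show ?thesis using u by blast
      qed
      then have "S \<in> private_sets ?R C I" by (auto simp: private_sets_def)
      then show ?thesis by blast
    qed
  qed
  have "card (private_sets_graph V E) \<le> card (private_sets ?R C I \<union> private_sets ?R I C \<union> (\<lambda>c. {c}) ` C)"
    using fin by (intro card_mono sub) (auto intro: finite_private_sets)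
  also have "\<dots> \<le> card (private_sets ?R C I) + card (private_sets ?R I C) + card ((\<lambda>c. {c}) ` C)"
    by (rule order_trans[OF card_Un_le add_right_mono[OF card_Un_le]])
  also have "\<dots> \<le> card (private_sets ?R C I) + card (private_sets ?R I C) + card V"
    using card_image_le[OF fin(1), of "\<lambda>c. {c}"] cards by linarith
  finally have "real (card (private_sets_graph V E))
      \<le> real (card (private_sets ?R C I)) + real (card (private_sets ?R I C)) + real (card V)" by linarith
  moreover have "real (card (private_sets ?R C I)) \<le> 1.4656 ^ card V"
    "real (card (private_sets ?R I C)) \<le> 1.4656 ^ card V"
    using card_private_sets[of "1.4656" C I ?R] card_private_sets[of "1.4656" I C ?R] fin cards
    by (simp_all add: power2_eq_square power3_eq_cube add.commute)
  moreover have "real (card V) * 1 \<le> real (card V) * 1.4656 ^ card V"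
    by (intro mult_left_mono one_le_power) auto
  ultimately show ?thesis by (simp add: algebra_simps)
qed

section \<open>Minimal Roman dominating functions and their sets of value 2\<close>

definition roman_of :: "'a set \<Rightarrow> 'a set set \<Rightarrow> 'a set \<Rightarrow> 'a \<Rightarrow> nat" where
  "roman_of V E S = (\<lambda>v\<in>V. if v \<in> S then 2 else if \<exists>u\<in>S. {v, u} \<in> E then 0 else 1)"

text \<open>From left to right, lowering a single value must destroy domination. From right to left,
  private neighbours force the value 2 on \<open>S\<close> in every rdf below
  \<open>f\<close>.\<close>

lemma minimal_rdf_iff:
  "minimal_rdf V E f \<longleftrightarrow> (\<exists>S\<in>private_sets_graph V E. f = roman_of V E S)"
proof
  assume min: "minimal_rdf V E f"
  define S where "S = {v \<in> V. f v = 2}"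
  have f: "f \<in> V \<rightarrow>\<^sub>E {0, 1, 2}" and dom: "\<And>v. v \<in> V \<Longrightarrow> f v = 0 \<Longrightarrow> \<exists>u\<in>V. {u, v} \<in> E \<and> f u = 2"
    using min by (auto simp: minimal_rdf_def rdf_def)
  have least: "g = f" if "rdf V E g" "\<forall>v\<in>V. g v \<le> f v" for g
    using min that by (auto simp: minimal_rdf_def)
  have upd: "\<exists>w\<in>V. (f(v := k)) w = 0 \<and> \<not> (\<exists>u\<in>V. {u, w} \<in> E \<and> (f(v := k)) u = 2)"
    if "v \<in> V" "k < f v" for v k
  proof (rule ccontr)
    assume neg: "\<not> ?thesis"
    have "f v \<in> {0, 1, 2}" using f that by blast
    then have "f(v := k) \<in> V \<rightarrow>\<^sub>E {0, 1, 2}" using f that by (auto simp: PiE_iff extensional_def)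
    then have "rdf V E (f(v := k))" unfolding rdf_def using neg by blast
    then have "f(v := k) = f" using that by (intro least) auto
    then show False using that by (metis fun_upd_same less_irrefl)
  qed
  have "f = roman_of V E S"
  proof
    fix v show "f v = roman_of V E S v"
    proof (cases "v \<in> V")
      case v: True
      then have "f v \<in> {0, 1, 2}" using f by blast
      then consider "f v = 0" | "f v = 1" | "f v = 2" by auto
      then show ?thesis
      proof cases
        case 1
        then show ?thesis using dom[OF v] v by (auto simp: roman_of_def S_def insert_commute)
      next
        case 2
        then obtain w where w: "w \<in> V" "(f(v := 0)) w = 0" "\<not> (\<exists>u\<in>V. {u, w} \<in> E \<and> (f(v := 0)) u = 2)"
          using upd[OF v, of 0] by auto
        \<comment> \<open>Lowering 1 to 0 removes no vertex of value 2, so only \<open>v\<close>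
          itself can become undominated.\<close>
        have wv: "w = v"
        proof (rule ccontr)
          assume "w \<noteq> v"
          then have "f w = 0" using w by simp
          then obtain u where "u \<in> V" "{u, w} \<in> E" "f u = 2" using dom w by blast
          then show False using w 2 by (metis fun_upd_other one_eq_numeral_iff semiring_norm(85))
        qed
        have "\<not> (\<exists>u\<in>S. {v, u} \<in> E)"
        proof
          assume "\<exists>u\<in>S. {v, u} \<in> E"
          then obtain u where "u \<in> V" "f u = 2" "{u, v} \<in> E" by (auto simp: S_def insert_commute)
          then show False using w wv 2 by (metis fun_upd_other one_eq_numeral_iff semiring_norm(85))
        qed
        then show ?thesis using 2 v by (auto simp: roman_of_def S_def)
      qed (use v in \<open>auto simp: roman_of_def S_def\<close>)
    qed (use f in \<open>auto simp: roman_of_def PiE_iff extensional_def\<close>)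
  qed
  moreover have "S \<in> private_sets_graph V E"
    unfolding private_sets_graph_def
  proof (intro CollectI conjI ballI)
    fix v assume v: "v \<in> S"
    then obtain w where w: "w \<in> V" "(f(v := 1)) w = 0" "\<not> (\<exists>u\<in>V. {u, w} \<in> E \<and> (f(v := 1)) u = 2)"
      using upd[of v 1] by (auto simp: S_def)
    \<comment> \<open>The lowered vertex keeps a positive value, so the failing vertex
      \<open>w\<close> is another one; it was dominated by \<open>v\<close> alone and is the private
      neighbour sought.\<close>
    then have w0: "w \<noteq> v" "f w = 0" by (auto split: if_splits)
    have "x = v" if "x \<in> S" "{w, x} \<in> E" for x
    proof (rule ccontr)
      assume "x \<noteq> v"
      then show False using w that by (auto simp: S_def insert_commute)
    qed
    moreover obtain x where "x \<in> S" "{w, x} \<in> E"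
      using dom[OF w(1) w0(2)] by (auto simp: S_def insert_commute)
    ultimately have "{x \<in> S. {w, x} \<in> E} = {v}" by blast
    then show "\<exists>u\<in>V - S. {w \<in> S. {u, w} \<in> E} = {v}"
      using w w0 by (intro bexI[of _ w]) (auto simp: S_def)
  qed (auto simp: S_def)
  ultimately show "\<exists>S\<in>private_sets_graph V E. f = roman_of V E S" by blast
next
  assume "\<exists>S\<in>private_sets_graph V E. f = roman_of V E S"
  then obtain S where SV: "S \<subseteq> V" and priv: "\<And>v. v \<in> S \<Longrightarrow> \<exists>u\<in>V - S. {w \<in> S. {u, w} \<in> E} = {v}"
    and f: "f = roman_of V E S"
    by (auto simp: private_sets_graph_def)
  have two: "f v = 2 \<longleftrightarrow> v \<in> S" if "v \<in> V" for v using that by (auto simp: f roman_of_def)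
  have "rdf V E f"
    unfolding rdf_def
  proof (intro conjI ballI impI)
    show "f \<in> V \<rightarrow>\<^sub>E {0, 1, 2}" by (auto simp: f roman_of_def)
    fix v assume "v \<in> V" "f v = 0"
    then obtain u where "u \<in> S" "{v, u} \<in> E" by (auto simp: f roman_of_def split: if_splits)
    then show "\<exists>u\<in>V. {u, v} \<in> E \<and> f u = 2"
      using two SV by (metis insert_commute subset_iff)
  qed
  moreover have "g = f" if g: "rdf V E g" "\<forall>v\<in>V. g v \<le> f v" for g
  proof -
    have gdom: "\<exists>u\<in>S. {v, u} \<in> E \<and> g u = 2" if v: "v \<in> V" "g v = 0" for v
    proof -
      obtain u where u: "u \<in> V" "{u, v} \<in> E" "g u = 2" using g v by (auto simp: rdf_def)
      \<comment> \<open>\<open>f\<close> takes no value above 2, so a 2 of \<open>g\<close> sits on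
        a 2 of \<open>f\<close>.\<close>
      then have "f u = 2" using g(2) by (auto simp: f roman_of_def split: if_splits)
      then show ?thesis using u two by (metis insert_commute)
    qed
    have gS: "g v = 2" if v: "v \<in> S" for v
    proof -
      obtain u where u: "u \<in> V - S" "{w \<in> S. {u, w} \<in> E} = {v}" using priv[OF v] by blast
      \<comment> \<open>The private neighbour \<open>u\<close> gets 0 from \<open>g\<close> too, and
        among the vertices of \<open>S\<close> only \<open>v\<close> can dominate it.\<close>
      then have "f u = 0" by (auto simp: f roman_of_def)
      then have "g u = 0" using g(2) u by fastforce
      then obtain x where "x \<in> S" "{u, x} \<in> E" "g x = 2" using gdom[of u] u by blast
      then have "x \<in> {w \<in> S. {u, w} \<in> E}" by blast
      then show ?thesis using u \<open>g x = 2\<close> by simp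
    qed
    show "g = f"
    proof
      fix v show "g v = f v"
      proof (cases "v \<in> V")
        case v: True
        consider "v \<in> S" | "v \<notin> S" "f v = 0" | "v \<notin> S" "f v = 1" "\<not> (\<exists>u\<in>S. {v, u} \<in> E)"
          using v by (cases "\<exists>u\<in>S. {v, u} \<in> E") (auto simp: f roman_of_def)
        then show ?thesis
        proof cases
          case 1
          then show ?thesis using gS two v by simp
        next
          case 2
          then show ?thesis using g(2) v by force
        next
          case 3
          then have "g v \<noteq> 0" using gdom v by blast
          moreover have "g v \<le> 1" using g(2) v 3 by force
          ultimately show ?thesis using 3 by simp
        qed
      next
        case False
        then show ?thesis using g(1) by (auto simp: rdf_def f roman_of_def PiE_iff extensional_def)
      qed
    qed
  qed
  ultimately show "minimal_rdf V E f" by (auto simp: minimal_rdf_def)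
qed

lemma inj_on_roman_of: "inj_on (roman_of V E) (Pow V)"
proof (rule inj_on_inverseI)
  fix S assume "S \<in> Pow V"
  then show "{v \<in> V. roman_of V E S v = 2} = S" by (auto simp: roman_of_def)
qed

section \<open>Weakest preconditions with cost\<close>

text \<open>As values and costs are unique, weakest preconditions are characterised by equations, which let
  the simplifier execute programs.\<close>

definition wp :: "program \<Rightarrow> tree list \<Rightarrow> expr \<Rightarrow> (tree \<Rightarrow> nat \<Rightarrow> bool) \<Rightarrow> bool" where
  "wp P env e Q \<longleftrightarrow> (\<exists>v t. eval P env e v t \<and> Q v t)"

definition wps :: "program \<Rightarrow> tree list \<Rightarrow> expr list \<Rightarrow> (tree list \<Rightarrow> nat \<Rightarrow> bool) \<Rightarrow> bool" where
  "wps P env es Q \<longleftrightarrow> (\<exists>vs t. evals P env es vs t \<and> Q vs t)"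

text \<open>No simp rule unfolds this constant, so the simplifier stops at function calls, where the
  specification of the callee is supplied.\<close>

definition wp_call :: "program \<Rightarrow> nat \<Rightarrow> tree list \<Rightarrow> (tree \<Rightarrow> nat \<Rightarrow> bool) \<Rightarrow> bool" where
  "wp_call P g vs Q \<longleftrightarrow> g < length P \<and> wp P vs (P ! g) Q"

inductive_simps eval_iffs:
  "eval P env (Arg i) v t" "eval P env MkLeaf v t" "eval P env (MkNode a b) v t"
  "eval P env (expr.Left e) v t" "eval P env (expr.Right e) v t" "eval P env (IfNode c a b) v t"
  "eval P env (Call g es) v t" "evals P env [] vs t" "evals P env (e # es) vs t"

lemma wp_Arg [simp]:
  "wp P env (Arg i) Q \<longleftrightarrow> i < length env \<and> Q (env ! i) 1"
  unfolding wp_def wps_def wp_call_def eval_iffs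
  by simp

lemma wp_MkLeaf [simp]:
  "wp P env MkLeaf Q \<longleftrightarrow> Q Leaf 1"
  unfolding wp_def wps_def wp_call_def eval_iffs
  by simp

lemma wp_MkNode [simp]:
  "wp P env (MkNode a b) Q \<longleftrightarrow> wp P env a (\<lambda>x s. wp P env b (\<lambda>y t. Q (Node x y) (s + t + 1)))"
  unfolding wp_def wps_def wp_call_def eval_iffs
  by (simp, metis)

lemma wp_Left [simp]:
  "wp P env (expr.Left e) Q \<longleftrightarrow> wp P env e (\<lambda>v t. \<exists>x y. v = Node x y \<and> Q x (t + 1))"
  unfolding wp_def wps_def wp_call_def eval_iffs
  by (simp, metis)

lemma wp_Right [simp]:
  "wp P env (expr.Right e) Q \<longleftrightarrow> wp P env e (\<lambda>v t. \<exists>x y. v = Node x y \<and> Q y (t + 1))"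
  unfolding wp_def wps_def wp_call_def eval_iffs
  by (simp, metis)

lemma wp_IfNode [simp]:
  "wp P env (IfNode c a b) Q \<longleftrightarrow> wp P env c (\<lambda>x s. wp P env (if x = Leaf then b else a) (\<lambda>v t. Q v (s + t + 1)))"
  unfolding wp_def wps_def wp_call_def eval_iffs
  proof (intro iffI; elim exE conjE disjE)
  fix x s v t assume "eval P env c x s" "eval P env (if x = Leaf then b else a) v t" "Q v (s + t + 1)"
  then show "\<exists>v t. ((\<exists>x y s t'. t = Suc (s + t') \<and> eval P env c (Node x y) s \<and> eval P env a v t') \<or>
     (\<exists>s t'. t = Suc (s + t') \<and> eval P env c Leaf s \<and> eval P env b v t')) \<and> Q v t"
    by (cases x; simp; blast)
next
  fix v t x y s t' assume "t = Suc (s + t')" "eval P env c (Node x y) s" "eval P env a v t'" "Q v t"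
  then show "\<exists>x s. eval P env c x s \<and> (\<exists>v t. eval P env (if x = Leaf then b else a) v t \<and> Q v (s + t + 1))"
    by (intro exI[of _ "Node x y"] exI[of _ s] conjI exI[of _ v] exI[of _ t']) simp_all
next
  fix v t s t' assume "t = Suc (s + t')" "eval P env c Leaf s" "eval P env b v t'" "Q v t"
  then show "\<exists>x s. eval P env c x s \<and> (\<exists>v t. eval P env (if x = Leaf then b else a) v t \<and> Q v (s + t + 1))"
    by (intro exI[of _ Leaf] exI[of _ s] conjI exI[of _ v] exI[of _ t']) simp_all
qed

lemma wp_Call [simp]:
  "wp P env (Call g es) Q \<longleftrightarrow> wps P env es (\<lambda>vs s. wp_call P g vs (\<lambda>v t. Q v (s + t + 1)))"
  unfolding wp_def wps_def wp_call_def eval_iffs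
  by (simp, metis)

lemma wps_Nil [simp]:
  "wps P env [] Q' \<longleftrightarrow> Q' [] 0"
  unfolding wp_def wps_def wp_call_def eval_iffs
  by simp

lemma wps_Cons [simp]:
  "wps P env (e # es) Q' \<longleftrightarrow> wp P env e (\<lambda>v s. wps P env es (\<lambda>vs t. Q' (v # vs) (s + t)))"
  unfolding wp_def wps_def wp_call_def eval_iffs
  by metis

definition returns :: "program \<Rightarrow> nat \<Rightarrow> tree list \<Rightarrow> tree \<Rightarrow> nat \<Rightarrow> bool" where
  "returns P g vs v b \<longleftrightarrow> wp_call P g vs (\<lambda>w t. w = v \<and> t \<le> b)"

text \<open>Determinism turns the existence of a run into an equation for every \<open>Q\<close>,
  usable as a rewrite rule although the exact cost \<open>t\<close> is unknown.\<close>

lemma returnsE: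
  assumes "returns P g vs v b"
  obtains t where "t \<le> b" "\<And>Q. wp_call P g vs Q \<longleftrightarrow> Q v t"
proof -
  from assms obtain t where g: "g < length P" and t: "t \<le> b" "eval P vs (P ! g) v t"
    by (auto simp: returns_def wp_call_def wp_def)
  have "wp_call P g vs Q \<longleftrightarrow> Q v t" for Q
    using eval_deterministic(1)[OF t(2)] t(2) g unfolding wp_call_def wp_def by metis
  with t that show ?thesis by blast
qed

lemma returnsI:
  "g < length P \<Longrightarrow> wp P vs (P ! g) (\<lambda>w t. w = v \<and> t \<le> b) \<Longrightarrow> returns P g vs v b"
  by (simp add: returns_def wp_call_def)

section \<open>The enumeration program\<close>

text \<open>\<open>Suc 0\<close> is the normal form to which the simplifier rewrites
  \<open>1\<close>.\<close>

abbreviation (input) "DISJOINT \<equiv> Suc 0"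
abbreviation (input) "SINGLE \<equiv> (2 :: nat)"
abbreviation (input) "PRIVATE \<equiv> (3 :: nat)"
abbreviation (input) "CHECK \<equiv> (4 :: nat)"
abbreviation (input) "INSERT \<equiv> (5 :: nat)"
abbreviation (input) "EMPTY \<equiv> (6 :: nat)"
abbreviation (input) "EXTEND \<equiv> (7 :: nat)"
abbreviation (input) "CHOOSE \<equiv> (8 :: nat)"
abbreviation (input) "GENERATE \<equiv> (9 :: nat)"
abbreviation (input) "ROMAN \<equiv> (10 :: nat)"
abbreviation (input) "OUTPUT \<equiv> (11 :: nat)"

abbreviation (input) "head i \<equiv> expr.Left (Arg i)"
abbreviation (input) "tail i \<equiv> expr.Right (Arg i)"
abbreviation (input) "true \<equiv> MkNode MkLeaf MkLeaf"
abbreviation (input) "false \<equiv> MkLeaf"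

text \<open>The matrix doubles as a counter: \<open>GENERATE\<close> consumes its first argument
  only for its length.\<close>

definition main_body :: expr where
  "main_body =
    Call OUTPUT [Call GENERATE [Arg 0, Arg 0], Arg 0]"

definition disjoint_body :: expr where
  "disjoint_body =
    IfNode (Arg 0)
      (IfNode (IfNode (head 0) (head 1) false) false (Call DISJOINT [tail 0, tail 1]))
      true"

definition single_body :: expr where
  "single_body =
    IfNode (Arg 0)
      (IfNode (IfNode (head 0) (head 1) false)
        (Call DISJOINT [tail 0, tail 1])
        (Call SINGLE [tail 0, tail 1]))
      false"

\<comment> \<open>Arguments: row of a vertex \<open>v\<close>, \<open>S\<close> and matrix (consumed in parallel), and all of \<open>S\<close>.\<close>
definition private_body :: expr where
  "private_body =
    IfNode (Arg 0)
      (IfNode (IfNode (head 0) (IfNode (head 1) false (Call SINGLE [head 2, Arg 3])) false)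
        true
        (Call PRIVATE [tail 0, tail 1, tail 2, Arg 3]))
      false"

\<comment> \<open>Arguments: \<open>S\<close> and matrix (consumed in parallel), and all of the matrix and of \<open>S\<close>.\<close>
definition check_body :: expr where
  "check_body =
    IfNode (Arg 0)
      (IfNode (IfNode (head 0) (Call PRIVATE [head 1, Arg 3, Arg 2, Arg 3]) true)
        (Call CHECK [tail 0, tail 1, Arg 2, Arg 3])
        false)
      true"

\<comment> \<open>Arguments: a list whose length is the number of the new vertex, and \<open>S\<close>.\<close>
definition insert_body :: expr where
  "insert_body =
    IfNode (Arg 0)
      (MkNode (head 1) (Call INSERT [tail 0, tail 1]))
      (MkNode true (tail 1))"

definition empty_body :: expr where
  "empty_body =
    IfNode (Arg 0) (MkNode false (Call EMPTY [tail 0])) MkLeaf"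

\<comment> \<open>Arguments: list of sets, a list whose length is the number of the new vertex, and matrix.\<close>
definition extend_body :: expr where
  "extend_body =
    IfNode (Arg 0)
      (Call CHOOSE [Call INSERT [Arg 1, head 0], head 0, Call EXTEND [tail 0, Arg 1, Arg 2], Arg 2])
      MkLeaf"

\<comment> \<open>Arguments: the set with and without the new vertex, the list to extend, and matrix.\<close>
definition choose_body :: expr where
  "choose_body =
    IfNode (Call CHECK [Arg 0, Arg 3, Arg 3, Arg 0])
      (MkNode (Arg 0) (MkNode (Arg 1) (Arg 2)))
      (MkNode (Arg 1) (Arg 2))"

\<comment> \<open>Arguments: a list whose length is the number of vertices to be considered, and matrix.\<close>
definition generate_body :: expr where
  "generate_body =
    IfNode (Arg 0)
      (Call EXTEND [Call GENERATE [tail 0, Arg 1], tail 0, Arg 1])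
      (MkNode (Call EMPTY [Arg 1]) MkLeaf)"

\<comment> \<open>Arguments: \<open>S\<close> and matrix (consumed in parallel), and all of \<open>S\<close>.\<close>
definition roman_body :: expr where
  "roman_body =
    IfNode (Arg 0)
      (MkNode (IfNode (head 0) (MkNode MkLeaf true) (Call DISJOINT [head 1, Arg 2]))
        (Call ROMAN [tail 0, tail 1, Arg 2]))
      MkLeaf"

definition output_body :: expr where
  "output_body =
    IfNode (Arg 0)
      (MkNode (Call ROMAN [head 0, Arg 1, head 0]) (Call OUTPUT [tail 0, Arg 1]))
      MkLeaf"

definition prog :: program where
  "prog = [main_body, disjoint_body, single_body, private_body, check_body, insert_body,
    empty_body, extend_body, choose_body, generate_body, roman_body, output_body]"

lemma prog_nth [simp]:
  "prog ! 0 = main_body"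
  "prog ! DISJOINT = disjoint_body"
  "prog ! SINGLE = single_body"
  "prog ! PRIVATE = private_body"
  "prog ! CHECK = check_body"
  "prog ! INSERT = insert_body"
  "prog ! EMPTY = empty_body"
  "prog ! EXTEND = extend_body"
  "prog ! CHOOSE = choose_body"
  "prog ! GENERATE = generate_body"
  "prog ! ROMAN = roman_body"
  "prog ! OUTPUT = output_body"
  by (simp_all add: prog_def)

lemmas body_defs =
  main_body_def disjoint_body_def single_body_def private_body_def check_body_def
  insert_body_def empty_body_def extend_body_def choose_body_def generate_body_def
  roman_body_def output_body_def

lemma length_prog [simp]: "length prog = 12"
  by (simp add: prog_def)

section \<open>Bit vectors and matrices as trees\<close>

abbreviation enc_bool :: "bool \<Rightarrow> tree" where
  "enc_bool b \<equiv> enc_nat (of_bool b)"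

lemma enc_nat_eq_Leaf [simp]: "enc_nat k = Leaf \<longleftrightarrow> k = 0"
  by (cases k) auto

text \<open>Suffixes starting at \<open>i\<close> turn recursion on lists into induction on the
  first index, shared by all lists consumed in parallel.\<close>

definition vec :: "nat \<Rightarrow> nat \<Rightarrow> (nat \<Rightarrow> bool) \<Rightarrow> tree" where
  "vec i n p = enc_list (map (\<lambda>j. enc_bool (p j)) [i..<n])"

definition rows :: "nat \<Rightarrow> nat \<Rightarrow> nat set set \<Rightarrow> tree" where
  "rows i n E = enc_list (map (\<lambda>u. vec 0 n (\<lambda>j. {u, j} \<in> E)) [i..<n])"

lemma vec_simps:
  "vec n n p = Leaf"
  "i < n \<Longrightarrow> vec i n p = Node (enc_bool (p i)) (vec (Suc i) n p)"
  by (simp_all add: vec_def upt_conv_Cons)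

lemma rows_simps:
  "rows n n E = Leaf"
  "i < n \<Longrightarrow> rows i n E = Node (vec 0 n (\<lambda>j. {i, j} \<in> E)) (rows (Suc i) n E)"
  by (simp_all add: rows_def upt_conv_Cons)

lemma enc_graph_eq: "enc_graph n E = rows 0 n E"
  by (simp add: enc_graph_def rows_def vec_def)

section \<open>Correctness and cost of the list functions\<close>

lemma atLeastLessThan_Suc_left: "i < n \<Longrightarrow> {i..<n} = insert i {Suc i..<n}"
  by auto

text \<open>\<open>k\<close> counts the remaining entries; 20 generously covers one call without its
  recursive call.\<close>

lemma returns_DISJOINT:
  "i + k = n \<Longrightarrow> returns prog DISJOINT [vec i n p, vec i n q]
     (enc_bool (\<forall>j\<in>{i..<n}. \<not> (p j \<and> q j))) (20 * (k + 1))"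
proof (induction k arbitrary: i)
  case 0
  then show ?case by (intro returnsI) (simp_all add: body_defs vec_simps)
next
  case (Suc k)
  then have "i < n" by simp
  from Suc.IH[of "Suc i"] Suc.prems obtain t where "t \<le> 20 * (k + 1)"
    "\<And>Q. wp_call prog DISJOINT [vec (Suc i) n p, vec (Suc i) n q] Q \<longleftrightarrow>
       Q (enc_bool (\<forall>j\<in>{Suc i..<n}. \<not> (p j \<and> q j))) t"
    by (auto elim: returnsE)
  with \<open>i < n\<close> show ?case
    by (intro returnsI) (simp_all add: body_defs vec_simps atLeastLessThan_Suc_left)
qed

lemma returns_SINGLE:
  "i + k = n \<Longrightarrow> returns prog SINGLE [vec i n p, vec i n q]
     (enc_bool (\<exists>!j. j \<in> {i..<n} \<and> p j \<and> q j)) (20 * (k + 2))"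
proof (induction k arbitrary: i)
  case 0
  then show ?case by (intro returnsI) (auto simp: body_defs vec_simps)
next
  case (Suc k)
  then have i: "i < n" by simp
  from Suc.IH[of "Suc i"] Suc.prems obtain t where t: "t \<le> 20 * (k + 2)"
    "\<And>Q. wp_call prog SINGLE [vec (Suc i) n p, vec (Suc i) n q] Q \<longleftrightarrow>
       Q (enc_bool (\<exists>!j. j \<in> {Suc i..<n} \<and> p j \<and> q j)) t"
    by (auto elim: returnsE)
  from returns_DISJOINT[of "Suc i" k n p q] Suc.prems obtain s where s: "s \<le> 20 * (k + 1)"
    "\<And>Q. wp_call prog DISJOINT [vec (Suc i) n p, vec (Suc i) n q] Q \<longleftrightarrow>
       Q (enc_bool (\<forall>j\<in>{Suc i..<n}. \<not> (p j \<and> q j))) s"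
    by (auto elim: returnsE)
  \<comment> \<open>A hit at \<open>i\<close> must be the only one, which is why
    \<open>DISJOINT\<close> takes over on the tails.\<close>
  have "(\<exists>!j. j \<in> {i..<n} \<and> p j \<and> q j) \<longleftrightarrow>
    (if p i \<and> q i then \<forall>j\<in>{Suc i..<n}. \<not> (p j \<and> q j) else \<exists>!j. j \<in> {Suc i..<n} \<and> p j \<and> q j)"
    using i unfolding atLeastLessThan_Suc_left[OF i] by (auto simp: Ball_def) (metis Suc_n_not_le_n)+
  with s t i show ?case
    by (intro returnsI) (simp_all add: body_defs vec_simps)
qed

text \<open>Abstracting the cost per entry to \<open>K\<close> keeps the arithmetic simple. In the
  application \<open>q\<close> and \<open>s\<close> are the same set, one copy being consumed and
  the other kept whole.\<close>

lemma returns_PRIVATE: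
  assumes K: "20 * n + 100 \<le> K"
  shows "i + k = n \<Longrightarrow> returns prog PRIVATE [vec i n p, vec i n q, rows i n E, vec 0 n s]
     (enc_bool (\<exists>u\<in>{i..<n}. p u \<and> \<not> q u \<and> (\<exists>!j. j \<in> {0..<n} \<and> {u, j} \<in> E \<and> s j))) ((k + 1) * K)"
proof (induction k arbitrary: i)
  case 0
  then show ?case using K by (intro returnsI) (auto simp: body_defs vec_simps rows_simps)
next
  case (Suc k)
  then have i: "i < n" by simp
  define P where "P u \<longleftrightarrow> (\<exists>!j. j \<in> {0..<n} \<and> {u, j} \<in> E \<and> s j)" for u
  from Suc.IH[of "Suc i"] Suc.prems obtain t where t: "t \<le> (k + 1) * K"
    "\<And>Q. wp_call prog PRIVATE [vec (Suc i) n p, vec (Suc i) n q, rows (Suc i) n E, vec 0 n s] Q \<longleftrightarrow>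
       Q (enc_bool (\<exists>u\<in>{Suc i..<n}. p u \<and> \<not> q u \<and> P u)) t"
    unfolding P_def by (auto elim: returnsE)
  from returns_SINGLE[of 0 n n "\<lambda>j. {i, j} \<in> E" s] obtain t' where t': "t' \<le> 20 * (n + 2)"
    "\<And>Q. wp_call prog SINGLE [vec 0 n (\<lambda>j. {i, j} \<in> E), vec 0 n s] Q \<longleftrightarrow> Q (enc_bool (P i)) t'"
    unfolding P_def by (auto elim: returnsE)
  show ?case
    unfolding P_def[symmetric] using t t' K
    by (intro returnsI)
      (simp_all add: body_defs vec_simps(2)[OF i] rows_simps(2)[OF i] atLeastLessThan_Suc_left[OF i])
qed

definition private_bits :: "nat \<Rightarrow> nat set set \<Rightarrow> (nat \<Rightarrow> bool) \<Rightarrow> nat \<Rightarrow> bool" where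
  "private_bits n E s v \<longleftrightarrow>
     (\<exists>u\<in>{0..<n}. {v, u} \<in> E \<and> \<not> s u \<and> (\<exists>!j. j \<in> {0..<n} \<and> {u, j} \<in> E \<and> s j))"

lemma returns_CHECK:
  assumes K: "(n + 1) * (20 * n + 100) + 100 \<le> K"
  shows "i + k = n \<Longrightarrow> returns prog CHECK [vec i n q, rows i n E, rows 0 n E, vec 0 n s]
     (enc_bool (\<forall>v\<in>{i..<n}. q v \<longrightarrow> private_bits n E s v)) ((k + 1) * K)"
proof (induction k arbitrary: i)
  case 0
  then show ?case using K by (intro returnsI) (auto simp: body_defs vec_simps rows_simps)
next
  case (Suc k)
  then have i: "i < n" by simp
  from Suc.IH[of "Suc i"] Suc.prems obtain t where t: "t \<le> (k + 1) * K"
    "\<And>Q. wp_call prog CHECK [vec (Suc i) n q, rows (Suc i) n E, rows 0 n E, vec 0 n s] Q \<longleftrightarrow>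
       Q (enc_bool (\<forall>v\<in>{Suc i..<n}. q v \<longrightarrow> private_bits n E s v)) t"
    by (auto elim: returnsE)
  from returns_PRIVATE[OF order_refl, of 0 n n "\<lambda>j. {i, j} \<in> E" s E s]
  obtain t' where "t' \<le> (n + 1) * (20 * n + 100)"
    "\<And>Q. wp_call prog PRIVATE [vec 0 n (\<lambda>j. {i, j} \<in> E), vec 0 n s, rows 0 n E, vec 0 n s] Q \<longleftrightarrow>
       Q (enc_bool (private_bits n E s i)) t'"
    unfolding private_bits_def by (auto elim: returnsE)
  moreover from this K have "t' + 100 \<le> K" by linarith
  ultimately show ?case
    using t
    by (intro returnsI)
      (simp_all add: body_defs vec_simps(2)[OF i] rows_simps(2)[OF i] atLeastLessThan_Suc_left[OF i])
qed

lemma returns_INSERT: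
  "i + length xs < n \<Longrightarrow> returns prog INSERT [enc_list xs, vec i n p]
     (vec i n (\<lambda>j. p j \<or> j = i + length xs)) (20 * (length xs + 1))"
proof (induction xs arbitrary: i)
  case Nil
  then have i: "i < n" by simp
  \<comment> \<open>The new index \<open>i\<close> lies before this suffix.\<close>
  have "vec (Suc i) n (\<lambda>j. p j \<or> j = i) = vec (Suc i) n p"
    unfolding vec_def by (intro arg_cong[of _ _ enc_list] map_cong) auto
  then show ?case by (intro returnsI) (simp_all add: body_defs vec_simps(2)[OF i])
next
  case (Cons x xs)
  then have i: "i < n" by simp
  from Cons.IH[of "Suc i"] Cons.prems obtain t where t: "t \<le> 20 * (length xs + 1)"
    "\<And>Q. wp_call prog INSERT [enc_list xs, vec (Suc i) n p] Q \<longleftrightarrow>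
       Q (vec (Suc i) n (\<lambda>j. p j \<or> j = Suc (i + length xs))) t"
    by (auto elim: returnsE)
  then show ?case by (intro returnsI) (simp_all add: body_defs vec_simps(2)[OF i])
qed

lemma returns_EMPTY:
  "i + k = n \<Longrightarrow> returns prog EMPTY [rows i n E] (vec i n (\<lambda>_. False)) (20 * (k + 1))"
proof (induction k arbitrary: i)
  case 0
  then show ?case by (intro returnsI) (simp_all add: body_defs vec_simps rows_simps)
next
  case (Suc k)
  then have i: "i < n" by simp
  from Suc.IH[of "Suc i"] Suc.prems obtain t where t: "t \<le> 20 * (k + 1)"
    "\<And>Q. wp_call prog EMPTY [rows (Suc i) n E] Q \<longleftrightarrow> Q (vec (Suc i) n (\<lambda>_. False)) t"
    by (auto elim: returnsE)
  then show ?case by (intro returnsI) (simp_all add: body_defs vec_simps(2)[OF i] rows_simps(2)[OF i])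
qed

section \<open>The family of sets built vertex by vertex\<close>

definition enc_set :: "nat \<Rightarrow> nat set \<Rightarrow> tree" where
  "enc_set n S = vec 0 n (\<lambda>j. j \<in> S)"

abbreviation enc_sets :: "nat \<Rightarrow> nat set list \<Rightarrow> tree" where
  "enc_sets n Ss \<equiv> enc_list (map (enc_set n) Ss)"

definition choices :: "nat \<Rightarrow> nat set set \<Rightarrow> nat set \<Rightarrow> nat set \<Rightarrow> nat set list" where
  "choices n E S' S = (if S' \<in> private_sets_graph {..<n} E then [S', S] else [S])"

text \<open>Models the lists built by the program including their order, since
  \<open>returns\<close> fixes the exact tree.\<close>

primrec sets :: "nat \<Rightarrow> nat set set \<Rightarrow> nat \<Rightarrow> nat set list" where
  "sets n E 0 = [{}]"
| "sets n E (Suc k) = concat (map (\<lambda>S. choices n E (insert k S) S) (sets n E k))"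

text \<open>If \<open>u\<close> is adjacent to \<open>v\<close> in \<open>S\<close> and has exactly
  one neighbour in \<open>S\<close>, that neighbour is \<open>v\<close>. So the program only counts
  and never compares vertices.\<close>

lemma private_bits_iff:
  assumes "S \<subseteq> {..<n}"
  shows "(\<forall>v\<in>{0..<n}. v \<in> S \<longrightarrow> private_bits n E (\<lambda>j. j \<in> S) v) \<longleftrightarrow> S \<in> private_sets_graph {..<n} E"
proof -
  have "private_bits n E (\<lambda>j. j \<in> S) v \<longleftrightarrow> (\<exists>u\<in>{..<n} - S. {w \<in> S. {u, w} \<in> E} = {v})" if "v \<in> S" for v
  proof -
    have eq: "{v, u} \<in> E \<and> (\<exists>!j. j \<in> {0..<n} \<and> {u, j} \<in> E \<and> j \<in> S) \<longleftrightarrow> {w \<in> S. {u, w} \<in> E} = {v}" for u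
    proof
      assume "{v, u} \<in> E \<and> (\<exists>!j. j \<in> {0..<n} \<and> {u, j} \<in> E \<and> j \<in> S)"
      then have "{u, v} \<in> E" and 1: "\<exists>!j. j \<in> {0..<n} \<and> {u, j} \<in> E \<and> j \<in> S"
        by (simp_all add: insert_commute)
      then have "w = v" if "w \<in> S" "{u, w} \<in> E" for w
        using that \<open>v \<in> S\<close> assms by (auto simp: subset_iff)
      then show "{w \<in> S. {u, w} \<in> E} = {v}" using \<open>{u, v} \<in> E\<close> \<open>v \<in> S\<close> by blast
    next
      assume eq: "{w \<in> S. {u, w} \<in> E} = {v}"
      then have iff: "w \<in> S \<and> {u, w} \<in> E \<longleftrightarrow> w = v" for w by (metis (mono_tags, lifting) mem_Collect_eq singleton_iff)
      then have "{v, u} \<in> E" "v < n" using iff[of v] assms by (auto simp: insert_commute[of v u])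
      then show "{v, u} \<in> E \<and> (\<exists>!j. j \<in> {0..<n} \<and> {u, j} \<in> E \<and> j \<in> S)"
        using iff by (auto intro!: ex1I[of _ v])
    qed
    have "private_bits n E (\<lambda>j. j \<in> S) v \<longleftrightarrow> (\<exists>u\<in>{0..<n}. u \<notin> S \<and>
        ({v, u} \<in> E \<and> (\<exists>!j. j \<in> {0..<n} \<and> {u, j} \<in> E \<and> j \<in> S)))"
      unfolding private_bits_def by blast
    then show ?thesis unfolding eq by auto
  qed
  then show ?thesis using assms by (auto simp: private_sets_graph_def)
qed

lemma returns_CHECK_set:
  assumes "S \<subseteq> {..<n}"
  shows "returns prog CHECK [enc_set n S, rows 0 n E, rows 0 n E, enc_set n S]
    (enc_bool (S \<in> private_sets_graph {..<n} E)) ((n + 1) * ((n + 1) * (20 * n + 100) + 100))"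
  using returns_CHECK[OF order_refl, of 0 n n "\<lambda>j. j \<in> S" E "\<lambda>j. j \<in> S"]
  by (simp add: private_bits_iff[OF assms] enc_set_def)

text \<open>As a function of its own, \<open>CHOOSE\<close> binds the new set by call-by-value, so
  that the set is built once although it is both tested and stored.\<close>

lemma returns_CHOOSE:
  assumes "S' \<subseteq> {..<n}" and K: "(n + 1) * ((n + 1) * (20 * n + 100) + 100) + 100 \<le> K"
  shows "returns prog CHOOSE [enc_set n S', enc_set n S, enc_sets n Ss, rows 0 n E]
     (enc_sets n (choices n E S' S @ Ss)) K"
proof -
  from returns_CHECK_set[OF assms(1), of E] obtain t where
    t: "t \<le> (n + 1) * ((n + 1) * (20 * n + 100) + 100)"
    "\<And>Q. wp_call prog CHECK [enc_set n S', rows 0 n E, rows 0 n E, enc_set n S'] Q \<longleftrightarrow>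
       Q (enc_bool (S' \<in> private_sets_graph {..<n} E)) t"
    by (auto elim: returnsE)
  from t(1) K have "t + 100 \<le> K" by linarith
  then show ?thesis
    by (intro returnsI) (simp_all add: body_defs t(2) choices_def)
qed

lemma returns_EXTEND:
  assumes K: "(n + 1) * ((n + 1) * (20 * n + 100) + 100) + 20 * n + 300 \<le> K" and idx: "length xs < n"
  shows "\<forall>S\<in>set Ss. S \<subseteq> {..<n} \<Longrightarrow> returns prog EXTEND [enc_sets n Ss, enc_list xs, rows 0 n E]
     (enc_sets n (concat (map (\<lambda>S. choices n E (insert (length xs) S) S) Ss))) ((length Ss + 1) * K)"
proof (induction Ss)
  case Nil
  then show ?case using K by (intro returnsI) (simp_all add: body_defs)
next
  case (Cons S Ss)
  let ?ext = "\<lambda>Ss. concat (map (\<lambda>S. choices n E (insert (length xs) S) S) Ss)"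
  from Cons.IH Cons.prems obtain t where t: "t \<le> (length Ss + 1) * K"
    "\<And>Q. wp_call prog EXTEND [enc_sets n Ss, enc_list xs, rows 0 n E] Q \<longleftrightarrow> Q (enc_sets n (?ext Ss)) t"
    by (auto elim: returnsE)
  have ins: "vec 0 n (\<lambda>j. j \<in> S \<or> j = length xs) = enc_set n (insert (length xs) S)"
    by (simp add: enc_set_def disj_commute)
  from returns_INSERT[of 0 xs n "\<lambda>j. j \<in> S"] idx obtain t1 where t1: "t1 \<le> 20 * (length xs + 1)"
    "\<And>Q. wp_call prog INSERT [enc_list xs, enc_set n S] Q \<longleftrightarrow> Q (enc_set n (insert (length xs) S)) t1"
    unfolding add_0 ins enc_set_def[symmetric] by (auto elim: returnsE)
  have "insert (length xs) S \<subseteq> {..<n}" using Cons.prems idx by simp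
  from returns_CHOOSE[OF this order_refl, of S "?ext Ss" E] obtain t2 where
    t2: "t2 \<le> (n + 1) * ((n + 1) * (20 * n + 100) + 100) + 100"
    "\<And>Q. wp_call prog CHOOSE [enc_set n (insert (length xs) S), enc_set n S, enc_sets n (?ext Ss), rows 0 n E] Q
       \<longleftrightarrow> Q (enc_sets n (choices n E (insert (length xs) S) S @ ?ext Ss)) t2"
    by (rule returnsE) blast
  have "t1 \<le> 20 * n" using t1(1) idx by simp
  then have "t1 + t2 + 100 \<le> K" using t2(1) K by linarith
  then show ?case
    using t t1(2) t2(2) by (intro returnsI) (simp_all add: body_defs)
qed

lemma sets_subset: "k \<le> n \<Longrightarrow> S \<in> set (sets n E k) \<Longrightarrow> S \<subseteq> {..<n}"
  by (induction k arbitrary: S) (auto simp: choices_def split: if_splits)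

text \<open>Completeness rests on heredity: \<open>S\<close> arises from \<open>S - {k}\<close>,
  which has survived the earlier stages.\<close>

lemma set_sets: "set (sets n E k) = {S \<in> private_sets_graph {..<n} E. S \<subseteq> {..<k}}"
proof (induction k)
  case 0
  show ?case by (auto simp: private_sets_graph_def)
next
  case (Suc k)
  have "S \<in> set (sets n E (Suc k)) \<longleftrightarrow> S \<in> private_sets_graph {..<n} E \<and> S \<subseteq> {..<Suc k}" for S
  proof
    assume "S \<in> set (sets n E (Suc k))"
    then show "S \<in> private_sets_graph {..<n} E \<and> S \<subseteq> {..<Suc k}"
      using Suc.IH by (auto simp: choices_def lessThan_Suc split: if_splits)
  next
    assume S: "S \<in> private_sets_graph {..<n} E \<and> S \<subseteq> {..<Suc k}"
    then have "S - {k} \<in> set (sets n E k)"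
      using Suc.IH private_sets_graph_hereditary[of S "{..<n}" E "S - {k}"] by (auto simp: lessThan_Suc)
    moreover have "S \<in> set (choices n E (insert k (S - {k})) (S - {k}))"
      using S by (cases "k \<in> S") (auto simp: choices_def insert_absorb)
    ultimately show "S \<in> set (sets n E (Suc k))"
      unfolding sets.simps set_concat set_map by blast
  qed
  then show ?case by blast
qed

text \<open>Removing \<open>k\<close> from a set recovers the one it was made from, so different
  sets have disjoint lists of choices.\<close>

lemma distinct_sets: "distinct (sets n E k)"
proof (induction k)
  case (Suc k)
  have sub: "S \<subseteq> {..<k}" if "S \<in> set (sets n E k)" for S
    using that by (simp add: set_sets)
  have "distinct (concat (map (\<lambda>S. choices n E (insert k S) S) Ss))"
    if "distinct Ss" "\<forall>S\<in>set Ss. k \<notin> S" for Ss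
    using that
  proof (induction Ss)
    case (Cons S Ss)
    have "T - {k} \<in> set Ss" if "T \<in> set (choices n E (insert k S') S')" "S' \<in> set Ss" for T S'
      using that Cons.prems by (auto simp: choices_def split: if_splits)
    moreover have "T - {k} = S" if "T \<in> set (choices n E (insert k S) S)" for T
      using that Cons.prems by (auto simp: choices_def split: if_splits)
    moreover have "distinct (choices n E (insert k S) S)"
      using Cons.prems by (auto simp: choices_def)
    ultimately show ?case using Cons by auto
  qed simp
  moreover have "\<forall>S\<in>set (sets n E k). k \<notin> S" using sub by blast
  ultimately show ?case using Suc.IH by simp
qed simp

text \<open>Every intermediate set is itself in the final family, so pruning leaves no dead ends and
  the cost is governed by the size of the output.\<close>

lemma length_sets: "length (sets n E k) \<le> card (private_sets_graph {..<n} E)"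
proof -
  have "length (sets n E k) = card (set (sets n E k))"
    by (simp add: distinct_card distinct_sets)
  also have "\<dots> \<le> card (private_sets_graph {..<n} E)"
    by (intro card_mono) (auto simp: set_sets intro: finite_private_sets_graph)
  finally show ?thesis .
qed

lemma returns_GENERATE:
  fixes M n K E
  defines "M \<equiv> card (private_sets_graph {..<n} E)"
  assumes K: "(M + 1) * ((n + 1) * ((n + 1) * (20 * n + 100) + 100) + 20 * n + 300) + 100 \<le> K"
  shows "length xs \<le> n \<Longrightarrow> returns prog GENERATE [enc_list xs, rows 0 n E]
     (enc_sets n (sets n E (length xs))) ((length xs + 1) * K)"
proof (induction xs)
  case Nil
  let ?E = "(n + 1) * ((n + 1) * (20 * n + 100) + 100) + 20 * n + 300"
  have "?E \<le> (M + 1) * ?E" by simp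
  then have "20 * n + 400 \<le> K" using K by linarith
  moreover from returns_EMPTY[of 0 n n E] obtain t where t: "t \<le> 20 * (n + 1)"
    "\<And>Q. wp_call prog EMPTY [rows 0 n E] Q \<longleftrightarrow> Q (enc_set n {}) t"
    unfolding enc_set_def by (auto elim: returnsE)
  ultimately show ?case by (intro returnsI) (simp_all add: body_defs)
next
  case (Cons x xs)
  let ?E = "(n + 1) * ((n + 1) * (20 * n + 100) + 100) + 20 * n + 300"
  from Cons obtain t where t: "t \<le> (length xs + 1) * K"
    "\<And>Q. wp_call prog GENERATE [enc_list xs, rows 0 n E] Q \<longleftrightarrow> Q (enc_sets n (sets n E (length xs))) t"
    by (auto elim: returnsE)
  have "\<forall>S\<in>set (sets n E (length xs)). S \<subseteq> {..<n}" "length xs < n"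
    using sets_subset[of "length xs" n] Cons.prems by auto
  from returns_EXTEND[OF order_refl this(2) this(1)] obtain t1 where
    t1: "t1 \<le> (length (sets n E (length xs)) + 1) * ?E"
    "\<And>Q. wp_call prog EXTEND [enc_sets n (sets n E (length xs)), enc_list xs, rows 0 n E] Q \<longleftrightarrow>
       Q (enc_sets n (sets n E (Suc (length xs)))) t1"
    unfolding sets.simps by (rule returnsE) blast
  have "(length (sets n E (length xs)) + 1) * ?E \<le> (M + 1) * ?E"
    unfolding M_def by (intro mult_right_mono add_right_mono length_sets) simp
  with t1(1) K have "t1 + 100 \<le> K" by linarith
  then show ?case using t t1(2)
    by (intro returnsI) (simp_all add: body_defs del: sets.simps)
qed

section \<open>Conversion of sets to functions, and total cost\<close>

lemma returns_ROMAN: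
  assumes K: "20 * n + 100 \<le> K"
  shows "i + k = n \<Longrightarrow> returns prog ROMAN [vec i n (\<lambda>j. j \<in> S), rows i n E, enc_set n S]
     (enc_list (map (\<lambda>j. enc_nat (if j \<in> S then 2 else of_bool (\<forall>u\<in>{0..<n}. \<not> ({j, u} \<in> E \<and> u \<in> S)))) [i..<n]))
     ((k + 1) * K)"
proof (induction k arbitrary: i)
  case 0
  then show ?case using K by (intro returnsI) (simp_all add: body_defs vec_simps rows_simps)
next
  case (Suc k)
  then have i: "i < n" by simp
  let ?f = "\<lambda>j. enc_nat (if j \<in> S then 2 else of_bool (\<forall>u\<in>{0..<n}. \<not> ({j, u} \<in> E \<and> u \<in> S)))"
  from Suc.IH[of "Suc i"] Suc.prems obtain t where t: "t \<le> (k + 1) * K"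
    "\<And>Q. wp_call prog ROMAN [vec (Suc i) n (\<lambda>j. j \<in> S), rows (Suc i) n E, enc_set n S] Q \<longleftrightarrow>
       Q (enc_list (map ?f [Suc i..<n])) t"
    by (rule_tac returnsE) auto
  \<comment> \<open>Outside \<open>S\<close> the truth value returned here is already the encoded
    function value: 1 without a neighbour in \<open>S\<close>, 0 with one.\<close>
  from returns_DISJOINT[of 0 n n "\<lambda>j. {i, j} \<in> E" "\<lambda>j. j \<in> S"] obtain t' where t': "t' \<le> 20 * (n + 1)"
    "\<And>Q. wp_call prog DISJOINT [vec 0 n (\<lambda>j. {i, j} \<in> E), enc_set n S] Q \<longleftrightarrow>
       Q (enc_bool (\<forall>u\<in>{0..<n}. \<not> ({i, u} \<in> E \<and> u \<in> S))) t'"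
    unfolding enc_set_def by (rule_tac returnsE) auto
  from t'(1) K have "t' + 20 \<le> K" by simp
  with t(1) t(2) t'(2) i K show ?case
    by (intro returnsI)
      (simp_all add: body_defs vec_simps(2)[OF i] rows_simps(2)[OF i] upt_conv_Cons numeral_2_eq_2)
qed

lemma returns_ROMAN_set:
  assumes "S \<subseteq> {..<n}"
  shows "returns prog ROMAN [enc_set n S, rows 0 n E, enc_set n S]
    (enc_fun n (roman_of {..<n} E S)) ((n + 1) * (20 * n + 100))"
proof -
  have "enc_list (map (\<lambda>j. enc_nat (if j \<in> S then 2 else of_bool (\<forall>u\<in>{0..<n}. \<not> ({j, u} \<in> E \<and> u \<in> S)))) [0..<n])
      = enc_fun n (roman_of {..<n} E S)"
    unfolding enc_fun_def using assms
    by (intro arg_cong[of _ _ enc_list] map_cong refl arg_cong[of _ _ enc_nat])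
      (auto simp: roman_of_def)
  then show ?thesis
    using returns_ROMAN[OF order_refl, of 0 n n S E] by (simp add: enc_set_def)
qed

lemma returns_OUTPUT:
  assumes K: "(n + 1) * (20 * n + 100) + 100 \<le> K"
  shows "\<forall>S\<in>set Ss. S \<subseteq> {..<n} \<Longrightarrow> returns prog OUTPUT [enc_sets n Ss, rows 0 n E]
     (enc_list (map (enc_fun n) (map (roman_of {..<n} E) Ss))) ((length Ss + 1) * K)"
proof (induction Ss)
  case Nil
  then show ?case using K by (intro returnsI) (simp_all add: body_defs)
next
  case (Cons S Ss)
  from Cons obtain t where t: "t \<le> (length Ss + 1) * K"
    "\<And>Q. wp_call prog OUTPUT [enc_sets n Ss, rows 0 n E] Q \<longleftrightarrow>
       Q (enc_list (map (enc_fun n) (map (roman_of {..<n} E) Ss))) t"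
    by (rule_tac returnsE) auto
  from returns_ROMAN_set[of S n E] Cons.prems obtain t' where t': "t' \<le> (n + 1) * (20 * n + 100)"
    "\<And>Q. wp_call prog ROMAN [enc_set n S, rows 0 n E, enc_set n S] Q \<longleftrightarrow>
       Q (enc_fun n (roman_of {..<n} E S)) t'"
    by (rule_tac returnsE) auto
  from t'(1) K have "t' + 100 \<le> K" by linarith
  then show ?case using t t'(2) by (intro returnsI) (simp_all add: body_defs)
qed

text \<open>The exponent 4 comes from \<open>n\<close> extension stages in which every set is tested
  at cubic cost; the output is cheaper, at quadratic cost per set.\<close>

lemma prog_enumerates:
  fixes n E
  defines "M \<equiv> card (private_sets_graph {..<n} E)"
  shows "\<exists>t \<le> 2000 * ((M + 1) * (n + 1) ^ 4). enumerates_minimal_rdfs prog n E t"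
proof -
  let ?KG = "(M + 1) * ((n + 1) * ((n + 1) * (20 * n + 100) + 100) + 20 * n + 300) + 100"
  let ?KO = "(n + 1) * (20 * n + 100) + 100"
  let ?fs = "map (roman_of {..<n} E) (sets n E n)"
  \<comment> \<open>The list of rows is taken as the counter \<open>xs\<close>, so that both
    arguments are the same tree.\<close>
  from returns_GENERATE[OF order_refl, where n = n and E = E
      and xs = "map (\<lambda>u. vec 0 n (\<lambda>j. {u, j} \<in> E)) [0..<n]"]
  obtain t where t: "t \<le> (n + 1) * ?KG"
    "\<And>Q. wp_call prog GENERATE [rows 0 n E, rows 0 n E] Q \<longleftrightarrow> Q (enc_sets n (sets n E n)) t"
    unfolding M_def rows_def[symmetric] by (rule_tac returnsE) auto
  have sub: "\<forall>S\<in>set (sets n E n). S \<subseteq> {..<n}" using sets_subset by blast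
  from returns_OUTPUT[OF order_refl sub, of E]
  obtain t' where t': "t' \<le> (length (sets n E n) + 1) * ?KO"
    "\<And>Q. wp_call prog OUTPUT [enc_sets n (sets n E n), rows 0 n E] Q \<longleftrightarrow>
       Q (enc_list (map (enc_fun n) ?fs)) t'"
    by (rule returnsE) blast
  have "(length (sets n E n) + 1) * ?KO \<le> (M + 1) * ?KO"
    unfolding M_def by (intro mult_right_mono add_right_mono length_sets) simp
  with t'(1) have t'_le: "t' \<le> (M + 1) * ?KO" by linarith
  have "\<exists>c. computes prog (enc_graph n E) (enc_list (map (enc_fun n) ?fs)) c \<and> c \<le> t + t' + 10"
  proof -
    have "wp prog [rows 0 n E] (Call 0 [Arg 0]) (\<lambda>v c. v = enc_list (map (enc_fun n) ?fs) \<and> c \<le> t + t' + 10)"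
      using t(2) t'(2) by (simp add: wp_call_def[of _ 0] main_body_def)
    then show ?thesis unfolding computes_def enc_graph_eq wp_def by blast
  qed
  then obtain c where c: "computes prog (enc_graph n E) (enc_list (map (enc_fun n) ?fs)) c" "c \<le> t + t' + 10"
    by blast
  have "distinct ?fs"
    using inj_on_subset[OF inj_on_roman_of, of "set (sets n E n)" "{..<n}" E] sub
    by (auto simp: distinct_map distinct_sets)
  moreover have "set ?fs = {f. minimal_rdf {..<n} E f}"
    by (auto simp: minimal_rdf_iff set_sets private_sets_graph_def)
  ultimately have "enumerates_minimal_rdfs prog n E c"
    using c(1) unfolding enumerates_minimal_rdfs_def by blast
  moreover have "c \<le> 2000 * ((M + 1) * (n + 1) ^ 4)"
  proof -
    \<comment> \<open>Lower terms are absorbed using \<open>1 \<le> L\<close> and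
      \<open>1 \<le> m\<close>: 600 for generation, 200 for output and 10 for the outer calls stay
      below 2000.\<close>
    define L m where "L = n + 1" and "m = M + 1"
    have L: "20 * n + 100 \<le> 100 * L" "1 \<le> m" by (simp_all add: L_def m_def)
    have pow: "L ^ i \<le> L ^ j" if "i \<le> j" for i j
      using that by (intro power_increasing) (simp_all add: L_def)
    have "L * (L * (20 * n + 100) + 100) + 20 * n + 300 \<le> L * (L * (100 * L) + 100) + 300 * L"
      using L by (intro add_mono[of _ _ "20 * n + 300", unfolded add.assoc[symmetric]] mult_left_mono add_right_mono)
        (auto simp: L_def)
    also have "\<dots> = 100 * L ^ 3 + 400 * L ^ 1" by (simp add: algebra_simps eval_nat_numeral)
    also have "\<dots> \<le> 500 * L ^ 3" using pow[of 1 3] by linarith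
    finally have "m * (L * (L * (20 * n + 100) + 100) + 20 * n + 300) + 100 \<le> m * (500 * L ^ 3) + m * (100 * L ^ 3)"
      using L pow[of 0 3] mult_mono[of 1 m 100 "100 * L ^ 3"] by (intro add_mono mult_left_mono) auto
    then have "L * (m * (L * (L * (20 * n + 100) + 100) + 20 * n + 300) + 100)
        \<le> L * (m * (500 * L ^ 3) + m * (100 * L ^ 3))"
      by (rule mult_left_mono) simp
    also have "\<dots> = 600 * (m * L ^ 4)" by (simp add: algebra_simps eval_nat_numeral)
    finally have 1: "t \<le> 600 * (m * L ^ 4)" using t(1) by (simp add: L_def m_def)
    have "L * (20 * n + 100) + 100 \<le> L * (100 * L) + 100" using L by (intro add_mono mult_left_mono) auto
    also have "\<dots> = 100 * L ^ 2 + 100" by (simp add: power2_eq_square)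
    also have "\<dots> \<le> 200 * L ^ 4" using pow[of 2 4] pow[of 0 4] by simp
    finally have "m * (L * (20 * n + 100) + 100) \<le> m * (200 * L ^ 4)" by (rule mult_left_mono) simp
    then have 2: "t' \<le> 200 * (m * L ^ 4)" using t'_le by (simp add: L_def m_def)
    have "1 \<le> m * L ^ 4" using L(2) pow[of 0 4] mult_mono[of 1 m 1 "L ^ 4"] by simp
    with 1 2 c(2) show ?thesis unfolding L_def m_def by linarith
  qed
  ultimately show ?thesis by blast
qed

section \<open>The asymptotic bound\<close>

theorem theorem2:
  shows "\<exists>(P :: program) (T :: nat \<Rightarrow> nat).
    (\<lambda>n. real (T n)) \<in> O\<^sup>*(\<lambda>n. 1.4656 ^ n) \<and>
    (\<forall>n E. split_graph {..<n} E \<longrightarrow> (\<exists>t \<le> T n. enumerates_minimal_rdfs P n E t))"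
proof -
  let ?B = "\<lambda>n. 2000 * (((real n + 2) * 1.4656 ^ n + 1) * (real n + 1) ^ 4)"
  \<comment> \<open>Costs are integers, so rounding the real bound down loses nothing.\<close>
  let ?T = "\<lambda>n. nat \<lfloor>?B n\<rfloor>"
  have "\<exists>t \<le> ?T n. enumerates_minimal_rdfs prog n E t" if "split_graph {..<n} E" for n E
  proof -
    obtain t where t: "t \<le> 2000 * ((card (private_sets_graph {..<n} E) + 1) * (n + 1) ^ 4)"
      "enumerates_minimal_rdfs prog n E t"
      using prog_enumerates by blast
    have "real t \<le> real (2000 * ((card (private_sets_graph {..<n} E) + 1) * (n + 1) ^ 4))"
      using t(1) by (rule of_nat_mono)
    also have "\<dots> = 2000 * ((real (card (private_sets_graph {..<n} E)) + 1) * (real n + 1) ^ 4)"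
      by (simp add: algebra_simps)
    also have "\<dots> \<le> ?B n"
      using card_private_sets_graph[OF that] by (intro mult_left_mono mult_right_mono add_right_mono) auto
    finally have "t \<le> ?T n" by linarith
    with t(2) show ?thesis by blast
  qed
  moreover have "(\<lambda>n. real (?T n)) \<in> O\<^sup>*(\<lambda>n. 1.4656 ^ n)"
    unfolding bigostar_def
  \<comment> \<open>One factor \<open>n\<close> comes from the number of sets and four from the cost
    per set. For \<open>n \<ge> 1\<close>, the constants 4 and \<open>2 ^ 4\<close> absorb the lower
    terms of \<open>(real n + 2) * x + 1\<close> and \<open>(real n + 1) ^ 4\<close>.\<close>
  proof (intro UN_I[of 5] UNIV_I bigoI[where c = "2000 * 4 * 2 ^ 4"] eventually_mono[OF eventually_ge_at_top[of 1]])
    fix n :: nat assume n: "1 \<le> n"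
    define x :: real where "x = 1.4656 ^ n"
    have x: "x \<ge> 1" unfolding x_def by (rule one_le_power) simp
    have "(real n + 2) * x + 1 \<le> (3 * real n) * x + real n * x"
      using n x by (intro add_mono mult_right_mono) (auto intro: mult_ge1_I)
    then have *: "(real n + 2) * x + 1 \<le> 4 * (real n * x)" by linarith
    have "real (?T n) \<le> ?B n" by simp
    also have "\<dots> \<le> 2000 * ((4 * (real n * x)) * (2 * real n) ^ 4)"
      using * n x unfolding x_def[symmetric] by (intro mult_left_mono mult_mono power_mono) auto
    also have "\<dots> = 2000 * 4 * 2 ^ 4 * (real n ^ 5 * x)"
      by (simp add: power_mult_distrib eval_nat_numeral)
    also have "\<dots> = 2000 * 4 * 2 ^ 4 * norm (real n ^ 5 * 1.4656 ^ n)"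
      using x by (simp add: x_def)
    finally show "norm (real (?T n)) \<le> 2000 * 4 * 2 ^ 4 * norm (real n ^ 5 * 1.4656 ^ n)" by simp
  qed
  ultimately show ?thesis by (intro exI[of _ prog] exI[of _ ?T] conjI allI impI)
qed

end
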